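(* Let $\Phi=(G,\hat{\mathbb V},\varphi)$ be a dual unit gain graph on $n$ vertices with vertex set $V$, and let $S\subseteq V$ with $|S|=k$, $1\le k\le n$. Let $\lambda_1\ge\lambda_2\ge\cdots\ge\lambda_n$ be the eigenvalues of the adjacency matrix $A(\Phi)$ and let $\mu_1\ge\mu_2\ge\cdots\ge\mu_k$ be the eigenvalues of $A(\Phi[S])$, where $\Phi[S]$ is the induced gain subgraph on $S$ (the induced subgraph $G[S]$ with gains restricted from $\varphi$), all ordered by the total order on dual numbers. Then $$\lambda_i\ \ge\ \mu_i\ \ge\ \lambda_{n+i-k}\qquad\text{for all }1\le i\le k.$$
   Context: Dual elements: let $\mathbb G\in\{\mathbb R,\mathbb C,\mathbb H\}$ and let $\epsilon$ be a symbol with $\epsilon\ne0$, $\epsilon^2=0$, commuting with $\mathbb G$. The ring $\hat{\mathbb G}$ consists of $a=a_s+a_d\epsilon$ with $a_s,a_d\in\mathbb G$; $(a_s+a_d\epsilon)(b_s+b_d\epsilon)=a_sb_s+(a_sb_d+a_db_s)\epsilon$. The conjugate is $a^*=a_s^*+a_d^*\epsilon$. Elements of $\hat{\mathbb R}$ are dual numbers, totally ordered by: $a>b$ iff $a_s>b_s$, or $a_s=b_s$ and $a_d>b_d$. The magnitude of $p=p_s+p_d\epsilon\in\hat{\mathbb G}$ is the dual number $|p|=|p_s|+\frac{p_s^*p_d+p_d^*p_s}{2|p_s|}\epsilon$ if $p_s\ne0$, and $|p|=|p_d|\epsilon$ otherwise. The group of unit dual elements is $\hat{\mathbb V}=\{p\in\hat{\mathbb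 G}:|p|=1\}$ (equivalently $|p_s|=1$ and $p_sp_d^*+p_dp_s^*=0$); for $\hat{\mathbb G}=\hat{\mathbb R},\hat{\mathbb C},\hat{\mathbb H}$ it is $\{\pm1\}$, the unit dual complex numbers $\hat{\mathbb T}$, and the unit dual quaternions $\hat{\mathbb U}$, respectively; inverses are conjugates. Dual unit gain graph: $G=(V,E)$ is a finite simple graph, $V=\{v_1,\dots,v_n\}$, and each edge $v_iv_j$ gives two oriented edges $e_{ij},e_{ji}$. A gain function is $\varphi$ from oriented edges to $\hat{\mathbb V}$ with $\varphi(e_{ji})=\varphi(e_{ij})^{-1}=\varphi(e_{ij})^*$; $\Phi=(G,\hat{\mathbb V},\varphi)$. Its adjacency matrix $A(\Phi)=(a_{ij})\in\hat{\mathbb G}^{n\times n}$ has $a_{ij}=\varphi(e_{ij})$ if $v_iv_j\in E$ and $a_{ij}=0$ otherwise; it is Hermitian ($A^*=A$, $*$ = conjugate transpose). Eigenvalues: $\lambda\in\hat{\mathbb G}$ is a (right) eigenvalue of $A\in\hat{\mathbb G}^{n\times n}$ if $A\mathbf x=\mathbf x\lambda$ for some $\mathbf x=\mathbf x_s+\mathbf x_d\epsilon$ with $\mathbf x_s\ne\mathbf 0$. Every $n\times n$ dual Hermitian matrix $A$ has exactly $n$ eigenvalues that are dual numbers (counted with multiplicity), i.e. there is a matrix $U$ with $U^*U=I$ and $U^*AU=\mathrm{diag}(\lambda_1,\dots,\lambda_n)$ with $\lambda_i\in\hat{\mathbb R}$, and this multiset is unique; "the eigenvalues" of a dual Hermitian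 matrix means these $n$ dual numbers. *)

theory Defs
  imports
    Complex_Main
    "Jordan_Normal_Form.Matrix"
    "Jordan_Normal_Form.Conjugate"
    "Graph_Theory.Graph_Theory"
begin

section \<open>Quaternions\<close>

datatype quat = Quat (qRe: real) (qI: real) (qJ: real) (qK: real)

lemma quat_eq_iff:
  "p = q \<longleftrightarrow> qRe p = qRe q \<and> qI p = qI q \<and> qJ p = qJ q \<and> qK p = qK q"
  by (cases p; cases q) auto

definition qnorm2 :: "quat \<Rightarrow> real" where
  "qnorm2 q = (qRe q)\<^sup>2 + (qI q)\<^sup>2 + (qJ q)\<^sup>2 + (qK q)\<^sup>2"

instantiation quat :: "{ring_1, conjugate, inverse, scaleR}"
begin

definition "0 = Quat 0 0 0 0"
definition "1 = Quat 1 0 0 0"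
definition "p + q = Quat (qRe p + qRe q) (qI p + qI q) (qJ p + qJ q) (qK p + qK q)"
definition "p - q = Quat (qRe p - qRe q) (qI p - qI q) (qJ p - qJ q) (qK p - qK q)"
definition "- q = Quat (- qRe q) (- qI q) (- qJ q) (- qK q)"
definition "p * q = Quat
  (qRe p * qRe q - qI p * qI q - qJ p * qJ q - qK p * qK q)
  (qRe p * qI q + qI p * qRe q + qJ p * qK q - qK p * qJ q)
  (qRe p * qJ q - qI p * qK q + qJ p * qRe q + qK p * qI q)
  (qRe p * qK q + qI p * qJ q - qJ p * qI q + qK p * qRe q)"
definition "r *\<^sub>R q = Quat (r * qRe q) (r * qI q) (r * qJ q) (r * qK q)"
definition "conjugate q = Quat (qRe q) (- qI q) (- qJ q) (- qK q)"
definition "inverse q = Quat (qRe q / qnorm2 q) (- qI q / qnorm2 q) (- qJ q / qnorm2 q)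
  (- qK q / qnorm2 q)"
definition "p div (q :: quat) = p * inverse q"

instance
  by standard (simp_all add: zero_quat_def one_quat_def plus_quat_def minus_quat_def
      uminus_quat_def times_quat_def conjugate_quat_def quat_eq_iff algebra_simps)

end

lemmas quat_defs = zero_quat_def one_quat_def plus_quat_def minus_quat_def uminus_quat_def
  times_quat_def scaleR_quat_def conjugate_quat_def inverse_quat_def divide_quat_def

lemma qnorm2_nonneg: "0 \<le> qnorm2 q"
  by (simp add: qnorm2_def)

lemma qnorm2_eq_0_iff: "qnorm2 q = 0 \<longleftrightarrow> q = 0"
  by (simp add: qnorm2_def quat_eq_iff zero_quat_def add_nonneg_eq_0_iff)

lemma qnorm2_mult: "qnorm2 (p * q) = qnorm2 p * qnorm2 q"
  by (simp add: qnorm2_def times_quat_def power2_eq_square algebra_simps)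

instantiation quat :: real_normed_div_algebra
begin

definition "norm q = sqrt (qnorm2 q)"
definition "sgn (q :: quat) = q /\<^sub>R norm q"
definition "dist p (q :: quat) = norm (p - q)"
definition [code del]:
  "(uniformity :: (quat \<times> quat) filter) = (INF e\<in>{0<..}. principal {(x, y). dist x y < e})"
definition [code del]:
  "open (U :: quat set) \<longleftrightarrow> (\<forall>x\<in>U. eventually (\<lambda>(x', y). x' = x \<longrightarrow> y \<in> U) uniformity)"

lemma norm_quat_eq: "norm q = sqrt ((sqrt ((qRe q)\<^sup>2 + (qI q)\<^sup>2))\<^sup>2 + (sqrt ((qJ q)\<^sup>2 + (qK q)\<^sup>2))\<^sup>2)"
  by (simp add: norm_quat_def qnorm2_def)

instance
proof
  fix a b :: real and x y z :: quat and U :: "quat set"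
  show "dist x y = norm (x - y)" "sgn x = x /\<^sub>R norm x"
    "(uniformity :: (quat \<times> quat) filter) = (INF e\<in>{0<..}. principal {(x, y). dist x y < e})"
    "open U \<longleftrightarrow> (\<forall>x\<in>U. eventually (\<lambda>(x', y). x' = x \<longrightarrow> y \<in> U) uniformity)"
    by (simp_all only: sgn_quat_def dist_quat_def uniformity_quat_def open_quat_def)
  show "a *\<^sub>R (x + y) = a *\<^sub>R x + a *\<^sub>R y" "(a + b) *\<^sub>R x = a *\<^sub>R x + b *\<^sub>R x"
    "a *\<^sub>R b *\<^sub>R x = (a * b) *\<^sub>R x" "1 *\<^sub>R x = x"
    "a *\<^sub>R x * y = a *\<^sub>R (x * y)" "x * a *\<^sub>R y = a *\<^sub>R (x * y)"
    by (simp_all add: quat_defs algebra_simps)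
  show "x div y = x * inverse y" "inverse (0 :: quat) = 0"
    by (simp_all add: quat_defs)
  show "inverse x * x = 1" "x * inverse x = 1" if "x \<noteq> 0"
  proof -
    have nz: "qnorm2 x \<noteq> 0" using that by (simp add: qnorm2_eq_0_iff)
    then have one: "qRe x * qRe x / qnorm2 x + qI x * qI x / qnorm2 x
      + qJ x * qJ x / qnorm2 x + qK x * qK x / qnorm2 x = 1"
      by (simp add: add_divide_distrib [symmetric])
        (simp add: qnorm2_def power2_eq_square)
    show "inverse x * x = 1" "x * inverse x = 1"
      using one by (simp_all add: quat_defs algebra_simps)
  qed
  show "norm x = 0 \<longleftrightarrow> x = 0"
    by (simp add: norm_quat_def qnorm2_eq_0_iff)
  show "norm (a *\<^sub>R x) = \<bar>a\<bar> * norm x"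
    by (simp add: norm_quat_def qnorm2_def scaleR_quat_def power_mult_distrib
        flip: distrib_left real_sqrt_abs real_sqrt_mult)
  show "norm (x * y) = norm x * norm y"
    by (simp add: norm_quat_def qnorm2_mult real_sqrt_mult)
  show "norm (x + y) \<le> norm x + norm y"
  proof -
    have "norm (x + y) \<le> sqrt ((sqrt ((qRe x)\<^sup>2 + (qI x)\<^sup>2) + sqrt ((qRe y)\<^sup>2 + (qI y)\<^sup>2))\<^sup>2
        + (sqrt ((qJ x)\<^sup>2 + (qK x)\<^sup>2) + sqrt ((qJ y)\<^sup>2 + (qK y)\<^sup>2))\<^sup>2)"
      unfolding norm_quat_eq
      by (intro real_sqrt_le_mono add_mono power_mono)
        (auto simp: plus_quat_def intro: real_sqrt_sum_squares_triangle_ineq)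
    also have "\<dots> \<le> norm x + norm y"
      unfolding norm_quat_eq by (rule real_sqrt_sum_squares_triangle_ineq)
    finally show ?thesis .
  qed
qed

end

section \<open>The scalars R, C and H\<close>

text \<open>
  A real normed division algebra with a conjugation such that \<open>x + x\<^sup>*\<close> is real and
  \<open>x\<^sup>* x = \<bar>x\<bar>\<^sup>2\<close>. Every element is then a root of the real quadratic
  \<open>t\<^sup>2 - (x + x\<^sup>*) t + \<bar>x\<bar>\<^sup>2\<close>, so by Frobenius' theorem the models are, up to isomorphism,
  exactly the reals, the complex numbers and the quaternions, each with its usual conjugation
  and absolute value; the three instances are given below.
\<close>

class gain_scalar = real_normed_div_algebra + conjugate +
  assumes conjugate_plus: "conjugate (x + y) = conjugate x + conjugate y"
    and conjugate_times: "conjugate (x * y) = conjugate y * conjugate x"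
    and conjugate_trace: "\<exists>r. x + conjugate x = r *\<^sub>R 1"
    and conjugate_mult_self: "conjugate x * x = (norm x)\<^sup>2 *\<^sub>R 1"

instance real :: gain_scalar
  by standard (auto simp: power2_eq_square)

instance complex :: gain_scalar
proof
  fix x y :: complex
  show "conjugate x * x = (norm x)\<^sup>2 *\<^sub>R 1"
    by (simp add: complex_norm_square mult.commute scaleR_conv_of_real del: of_real_power)
  show "\<exists>r. x + conjugate x = r *\<^sub>R 1"
    by (rule exI [of _ "2 * Re x"]) (simp add: complex_add_cnj scaleR_conv_of_real)
qed simp_all

instance quat :: gain_scalar
proof
  fix x y :: quat
  show "conjugate (x + y) = conjugate x + conjugate y"
    "conjugate (x * y) = conjugate y * conjugate x"
    by (simp_all add: quat_defs algebra_simps)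
  have "x + conjugate x = (2 * qRe x) *\<^sub>R 1"
    by (simp add: quat_defs)
  then show "\<exists>r. x + conjugate x = r *\<^sub>R 1" ..
  show "conjugate x * x = (norm x)\<^sup>2 *\<^sub>R 1"
    by (simp add: norm_quat_def qnorm2_nonneg)
      (simp add: qnorm2_def quat_defs power2_eq_square algebra_simps)
qed

section \<open>Dual elements\<close>

text \<open>\<open>Dual a b\<close> stands for \<open>a + b \<epsilon>\<close>.\<close>

datatype 'a dual_elem = Dual (std_part: 'a) (dual_part: 'a)

lemma dual_elem_eq_iff:
  "p = q \<longleftrightarrow> std_part p = std_part q \<and> dual_part p = dual_part q"
  by (cases p; cases q) auto

instantiation dual_elem :: (ring_1) ring_1
begin

definition "0 = Dual 0 0"
definition "1 = Dual 1 0"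
definition "p + q = Dual (std_part p + std_part q) (dual_part p + dual_part q)"
definition "p - q = Dual (std_part p - std_part q) (dual_part p - dual_part q)"
definition "- p = Dual (- std_part p) (- dual_part p)"
definition "p * q = Dual (std_part p * std_part q)
  (std_part p * dual_part q + dual_part p * std_part q)"

instance
  by standard (auto simp: zero_dual_elem_def one_dual_elem_def plus_dual_elem_def
      minus_dual_elem_def uminus_dual_elem_def times_dual_elem_def dual_elem_eq_iff algebra_simps)

end

instantiation dual_elem :: (conjugate) conjugate
begin

definition "conjugate p = Dual (conjugate (std_part p)) (conjugate (dual_part p))"

instance
  by standard (auto simp: conjugate_dual_elem_def dual_elem_eq_iff)

end

instantiation dual_elem :: (linorder) linorder
begin

definition "p < q \<longleftrightarrow>
  std_part p < std_part q \<or> std_part p = std_part q \<and> dual_part p < dual_part q"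
definition "p \<le> q \<longleftrightarrow> p < q \<or> p = (q :: 'a dual_elem)"

instance
  by standard (auto simp: less_dual_elem_def less_eq_dual_elem_def dual_elem_eq_iff)

end

definition of_dual_number :: "real dual_elem \<Rightarrow> 'a :: gain_scalar dual_elem" where
  "of_dual_number a = Dual (of_real (std_part a)) (of_real (dual_part a))"

text \<open>The magnitude is a dual number; it is given here as an element of the copy of the dual
  numbers inside the dual elements over \<^typ>\<open>'a\<close>.\<close>

definition dual_magnitude :: "'a :: gain_scalar dual_elem \<Rightarrow> 'a dual_elem" where
  "dual_magnitude p =
    (let s = std_part p; d = dual_part p in
     if s \<noteq> 0
     then Dual (of_real (norm s)) ((conjugate s * d + conjugate d * s) /\<^sub>R (2 * norm s))
     else Dual 0 (of_real (norm d)))"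

lemma dual_magnitude_dual_number: "dual_magnitude p \<in> range of_dual_number"
proof -
  have "conjugate s * d + conjugate d * s \<in> \<real>" for s d :: 'a
    using conjugate_trace [of "conjugate s * d"]
    by (auto simp: conjugate_times simp flip: of_real_def)
  then have real: "(conjugate s * d + conjugate d * s) /\<^sub>R (2 * norm s) \<in> \<real>" for s d :: 'a
    unfolding scaleR_conv_of_real by (intro Reals_mult Reals_of_real)
  obtain a where "dual_magnitude p = of_dual_number a"
  proof (cases "std_part p = 0")
    case True
    then show ?thesis
      by (intro that [of "Dual 0 (norm (dual_part p))"])
        (simp add: dual_magnitude_def of_dual_number_def Let_def)
  next
    case False
    obtain r where "(conjugate (std_part p) * dual_part p + conjugate (dual_part p) * std_part p)
        /\<^sub>R (2 * norm (std_part p)) = of_real r"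
      using real by (metis Reals_cases)
    with False show ?thesis
      by (intro that [of "Dual (norm (std_part p)) r"])
        (simp add: dual_magnitude_def of_dual_number_def Let_def)
  qed
  then show ?thesis by blast
qed

definition unit_dual :: "'a :: gain_scalar dual_elem set" where
  "unit_dual = {p. dual_magnitude p = 1}"

lemma unit_dual_conjugate:
  assumes "p \<in> unit_dual"
  shows "conjugate p * p = 1"
proof -
  have nz: "std_part p \<noteq> 0"
    using assms by (auto simp: unit_dual_def dual_magnitude_def one_dual_elem_def Let_def split: if_splits)
  with assms have "of_real (norm (std_part p)) = (1 :: 'a)"
    and *: "(conjugate (std_part p) * dual_part p + conjugate (dual_part p) * std_part p)
        /\<^sub>R (2 * norm (std_part p)) = 0"
    by (auto simp: unit_dual_def dual_magnitude_def one_dual_elem_def Let_def)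
  then have "norm (std_part p) = 1" using of_real_eq_1_iff by blast
  moreover from * nz have "conjugate (std_part p) * dual_part p + conjugate (dual_part p) * std_part p = 0"
    by simp
  ultimately show ?thesis
    by (simp add: times_dual_elem_def conjugate_dual_elem_def one_dual_elem_def conjugate_mult_self)
qed

section \<open>Eigenvalues of dual Hermitian matrices\<close>

text \<open>The adjoint of the matrix library is restricted to matrices over commutative fields.\<close>

definition dual_adjoint :: "'a :: gain_scalar dual_elem mat \<Rightarrow> 'a dual_elem mat" where
  "dual_adjoint A = map_mat conjugate (transpose_mat A)"

text \<open>\<open>ls\<close> lists, with multiplicity and in some order, the eigenvalues of the \<open>n \<times> n\<close> matrix
  \<open>A\<close> that are dual numbers.\<close>

definition eigenvalue_list :: "'a :: gain_scalar dual_elem mat \<Rightarrow> real dual_elem list \<Rightarrow> bool" where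
  "eigenvalue_list A ls \<longleftrightarrow>
    (let n = dim_row A in
     dim_col A = n \<and> length ls = n \<and>
     (\<exists>U \<in> carrier_mat n n.
        dual_adjoint U * U = 1\<^sub>m n \<and>
        dual_adjoint U * A * U = mat_diag n (\<lambda>i. of_dual_number (ls ! i))))"

section \<open>Dual unit gain graphs\<close>

text \<open>A finite simple graph is a symmetric loop-free digraph whose arcs are pairs, so that an
  edge \<open>uv\<close> contributes the oriented edges \<open>(u,v)\<close> and \<open>(v,u)\<close>. Only the values of the gain
  function on arcs matter.\<close>

locale dual_unit_gain_graph = pair_graph G
  for G :: "'v pair_pre_digraph" +
  fixes \<phi> :: "'v \<times> 'v \<Rightarrow> 'a :: gain_scalar dual_elem"
  assumes gain_unit: "e \<in> parcs G \<Longrightarrow> \<phi> e \<in> unit_dual"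
    and gain_reverse: "(u, v) \<in> parcs G \<Longrightarrow> \<phi> (v, u) = conjugate (\<phi> (u, v))"

text \<open>The list \<open>vs\<close> enumerates the vertices. The graph argument is a general digraph with pairs as
  arcs so that it can also be an induced subgraph \<open>with_proj G \<restriction> S\<close>.\<close>

definition adjacency_matrix ::
  "('v, 'v \<times> 'v) pre_digraph \<Rightarrow> ('v \<times> 'v \<Rightarrow> 'a :: gain_scalar dual_elem) \<Rightarrow> 'v list \<Rightarrow> 'a dual_elem mat"
where
  "adjacency_matrix H \<phi> vs = mat (length vs) (length vs)
    (\<lambda>(i, j). if (vs ! i, vs ! j) \<in> arcs H then \<phi> (vs ! i, vs ! j) else 0)"

end

theory Submission
  imports Defs
begin

text \<open>
  The classical proof of Cauchy interlacing by Rayleigh quotients survives over the dual elements.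
  Put one span of eigenvectors of \<open>A(\<Phi>)\<close> and one of eigenvectors of \<open>A(\<Phi>[S])\<close> (padded with zeros)
  into the \<open>n\<close>-dimensional space, with \<open>n + 1\<close> vectors in total. Both families are orthonormal,
  so a vector in both spans has the same squared length in either coordinates, and comparing its
  quadratic form in the two coordinate systems bounds one eigenvalue by the other. Over a ring with
  zero divisors it must be ensured that this vector has a nonzero standard part. Of two dual
  elements one always divides the other, hence in each linear equation one unknown can be expressed
  through the remaining ones, and a system with more unknowns than equations has a solution in
  which some free unknown equals \<open>1\<close>.
\<close>

section \<open>Arithmetic of dual elements\<close>

lemma dual_elem_sel [simp]:
  "std_part (0 :: 'a :: ring_1 dual_elem) = 0" "dual_part (0 :: 'a dual_elem) = 0"
  "std_part (1 :: 'a dual_elem) = 1" "dual_part (1 :: 'a dual_elem) = 0"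
  "std_part (p + q) = std_part p + std_part (q :: 'a dual_elem)"
  "dual_part (p + q) = dual_part p + dual_part (q :: 'a dual_elem)"
  "std_part (p * q) = std_part p * std_part (q :: 'a dual_elem)"
  "dual_part (p * q) = std_part p * dual_part q + dual_part p * std_part (q :: 'a dual_elem)"
  by (simp_all add: zero_dual_elem_def one_dual_elem_def plus_dual_elem_def times_dual_elem_def)

lemma std_part_sum:
  fixes f :: "'b \<Rightarrow> 'a :: ring_1 dual_elem"
  shows "std_part (sum f A) = (\<Sum>x\<in>A. std_part (f x))"
  by (induction A rule: infinite_finite_induct) auto

instance dual_elem :: (linordered_idom) ordered_ring
proof
  fix a b c :: "'a dual_elem"
  show "a \<le> b \<Longrightarrow> c + a \<le> c + b"
    by (auto simp: less_eq_dual_elem_def less_dual_elem_def dual_elem_eq_iff)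
  show "a \<le> b \<Longrightarrow> 0 \<le> c \<Longrightarrow> c * a \<le> c * b"
    by (auto simp: less_eq_dual_elem_def less_dual_elem_def dual_elem_eq_iff)
  show "a \<le> b \<Longrightarrow> 0 \<le> c \<Longrightarrow> a * c \<le> b * c"
    by (auto simp: less_eq_dual_elem_def less_dual_elem_def dual_elem_eq_iff)
qed

lemma dual_mult_right_le_imp_le:
  fixes a b c :: "'a :: linordered_idom dual_elem"
  assumes "a * c \<le> b * c" and "0 < std_part c"
  shows "a \<le> b"
  using assms by (auto simp: less_eq_dual_elem_def less_dual_elem_def dual_elem_eq_iff)

lemma of_dual_number_0 [simp]: "of_dual_number 0 = 0"
  and of_dual_number_1 [simp]: "of_dual_number 1 = 1"
  and of_dual_number_add: "of_dual_number (a + b) = of_dual_number a + of_dual_number b"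
  by (simp_all add: of_dual_number_def dual_elem_eq_iff)

lemma of_dual_number_sum: "of_dual_number (sum f A) = (\<Sum>x\<in>A. of_dual_number (f x))"
  by (induction A rule: infinite_finite_induct) (auto simp: of_dual_number_add)

lemma of_dual_number_eq_iff [simp]:
  "of_dual_number a = (of_dual_number b :: 'a :: gain_scalar dual_elem) \<longleftrightarrow> a = b"
  by (simp add: of_dual_number_def dual_elem_eq_iff)

lemma conjugate_0 [simp]: "conjugate (0 :: 'a :: gain_scalar) = 0"
  using conjugate_plus [of "0 :: 'a" 0] by simp

lemma dual_conjugate_0 [simp]: "conjugate (0 :: 'a :: gain_scalar dual_elem) = 0"
  and dual_conjugate_add:
    "conjugate (p + q) = conjugate p + conjugate (q :: 'a :: gain_scalar dual_elem)"
  and dual_conjugate_mult: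
    "conjugate (p * q) = conjugate q * conjugate (p :: 'a :: gain_scalar dual_elem)"
  by (simp_all add: conjugate_dual_elem_def dual_elem_eq_iff conjugate_plus conjugate_times)

lemma dual_conjugate_sum:
  fixes f :: "'b \<Rightarrow> 'a :: gain_scalar dual_elem"
  shows "conjugate (sum f A) = (\<Sum>x\<in>A. conjugate (f x))"
  by (induction A rule: infinite_finite_induct) (auto simp: dual_conjugate_add)

lemma conjugate_mult_self_dual_number:
  fixes b :: "'a :: gain_scalar dual_elem"
  obtains r where "0 \<le> r" "std_part r = (norm (std_part b))\<^sup>2"
    "\<And>c. conjugate b * of_dual_number c * b = of_dual_number (c * r)"
proof -
  obtain t where t: "conjugate (std_part b) * dual_part b + conjugate (dual_part b) * std_part b = of_real t"
    using conjugate_trace [of "conjugate (std_part b) * dual_part b"]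
    by (auto simp: conjugate_times of_real_def)
  have s: "conjugate (std_part b) * std_part b = of_real ((norm (std_part b))\<^sup>2)"
    by (simp add: conjugate_mult_self of_real_def)
  define r where "r = Dual ((norm (std_part b))\<^sup>2) t"
  show thesis
  proof (rule that [of r])
    show "0 \<le> r"
    proof (cases "std_part b = 0")
      case True
      then have "t = 0" using t by simp
      then show ?thesis by (simp add: r_def True less_eq_dual_elem_def dual_elem_eq_iff)
    next
      case False
      then show ?thesis by (simp add: r_def less_eq_dual_elem_def less_dual_elem_def)
    qed
    show "std_part r = (norm (std_part b))\<^sup>2" by (simp add: r_def)
    fix c
    have "conjugate b * of_dual_number c = of_dual_number c * conjugate b"
      by (simp add: dual_elem_eq_iff of_dual_number_def of_real_def)
    then have "conjugate b * of_dual_number c * b = of_dual_number c * (conjugate b * b)"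
      by (simp add: mult.assoc)
    also have "conjugate b * b = of_dual_number r"
      by (simp add: dual_elem_eq_iff of_dual_number_def r_def conjugate_dual_elem_def s t del: of_real_power)
    also have "of_dual_number c * of_dual_number r = of_dual_number (c * r)"
      by (simp add: of_dual_number_def dual_elem_eq_iff)
    finally show "conjugate b * of_dual_number c * b = of_dual_number (c * r)" .
  qed
qed

section \<open>Underdetermined linear systems\<close>

lemma dual_elem_dvd_total:
  fixes x y :: "'a :: real_normed_div_algebra dual_elem"
  shows "(\<exists>c. y = x * c) \<or> (\<exists>c. x = y * c)"
proof -
  have unit: "\<exists>c. q = p * c" if "std_part p \<noteq> 0" for p q :: "'a dual_elem"
  proof
    let ?i = "inverse (std_part p)"
    show "q = p * Dual (?i * std_part q) (?i * (dual_part q - dual_part p * (?i * std_part q)))"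
      using that by (simp add: dual_elem_eq_iff flip: mult.assoc)
  qed
  have eps: "\<exists>c. q = p * c" if "std_part p = 0" "std_part q = 0" "dual_part p \<noteq> 0"
    for p q :: "'a dual_elem"
    using that by (intro exI [of _ "Dual (inverse (dual_part p) * dual_part q) 0"])
      (simp add: dual_elem_eq_iff flip: mult.assoc)
  consider "std_part x \<noteq> 0" | "std_part y \<noteq> 0" | "std_part x = 0" "std_part y = 0" "dual_part x \<noteq> 0"
    | "x = 0"
    by (auto simp: dual_elem_eq_iff)
  then show ?thesis
  proof cases
    case 4
    then have "x = y * 0" by simp
    then show ?thesis by blast
  qed (use unit eps in blast)+
qed

lemma dual_elem_common_divisor:
  fixes f :: "'k \<Rightarrow> 'a :: real_normed_div_algebra dual_elem"
  assumes "finite K" "K \<noteq> {}"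
  shows "\<exists>p\<in>K. \<forall>k\<in>K. \<exists>c. f k = f p * c"
  using assms
proof (induction K rule: finite_ne_induct)
  case (singleton x)
  have "f x = f x * 1" by simp
  then show ?case by blast
next
  case (insert x K)
  then obtain p where p: "p \<in> K" "\<forall>k\<in>K. \<exists>c. f k = f p * c" by blast
  have refl: "f x = f x * 1" by simp
  show ?case
  proof (cases "\<exists>c. f x = f p * c")
    case True
    then show ?thesis using p by auto
  next
    case False
    then obtain d where "f p = f x * d" using dual_elem_dvd_total by blast
    then have "\<forall>k\<in>K. \<exists>c. f k = f x * c"
      using p by (metis mult.assoc)
    then show ?thesis using refl by blast
  qed
qed

lemma underdetermined_system_solution:
  fixes m :: "'i \<Rightarrow> 'k \<Rightarrow> 'a :: real_normed_div_algebra dual_elem"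
  assumes "finite I" "finite K" "card I < card K"
  shows "\<exists>x. (\<forall>i\<in>I. (\<Sum>k\<in>K. m i k * x k) = 0) \<and> (\<exists>k\<in>K. std_part (x k) \<noteq> 0)"
  using assms
proof (induction I arbitrary: K m rule: finite_induct)
  case empty
  then have "K \<noteq> {}" by auto
  then show ?case by (intro exI [of _ "\<lambda>_. 1"]) auto
next
  case (insert i I)
  then have "K \<noteq> {}" by auto
  then obtain p where p: "p \<in> K" and "\<forall>k\<in>K. \<exists>c. m i k = m i p * c"
    using dual_elem_common_divisor [of K "m i"] insert.prems by blast
  then obtain c where c: "\<And>k. k \<in> K \<Longrightarrow> m i k = m i p * c k" by metis
  let ?K = "K - {p}"
  have "card I < card ?K" using insert p by simp
  then obtain x where x: "\<And>i'. i' \<in> I \<Longrightarrow> (\<Sum>k\<in>?K. (m i' k - m i' p * c k) * x k) = 0"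
    and nz: "\<exists>k\<in>?K. std_part (x k) \<noteq> 0"
    using insert.IH [of ?K "\<lambda>i' k. m i' k - m i' p * c k"] insert.prems by auto
  define y where "y = x(p := - (\<Sum>k\<in>?K. c k * x k))"
  have y: "(\<Sum>k\<in>K. m j k * y k) = (\<Sum>k\<in>?K. (m j k - m j p * c k) * x k)" for j
  proof -
    have "(\<Sum>k\<in>K. m j k * y k) = m j p * y p + (\<Sum>k\<in>?K. m j k * y k)"
      using insert.prems p by (simp add: sum.remove)
    also have "(\<Sum>k\<in>?K. m j k * y k) = (\<Sum>k\<in>?K. m j k * x k)"
      by (intro sum.cong) (auto simp: y_def)
    also have "m j p * y p = - (\<Sum>k\<in>?K. m j p * c k * x k)"
      by (simp add: y_def sum_distrib_left mult.assoc)
    finally show ?thesis by (simp add: left_diff_distrib sum_subtractf)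
  qed
  have "(\<Sum>k\<in>K. m j k * y k) = 0" if "j \<in> insert i I" for j
  proof (cases "j = i")
    case True
    have "(\<Sum>k\<in>?K. (m i k - m i p * c k) * x k) = 0"
      by (intro sum.neutral) (use c in auto)
    then show ?thesis using y True by simp
  qed (use that x y in auto)
  moreover have "\<exists>k\<in>K. std_part (y k) \<noteq> 0"
    using nz by (auto simp: y_def)
  ultimately show ?case by blast
qed

section \<open>Comparison of Rayleigh quotients\<close>

lemma quadratic_form_diagonal:
  fixes u :: "'j \<Rightarrow> 'v \<Rightarrow> 'a :: gain_scalar dual_elem"
  assumes "finite J"
    and diag: "\<And>j l. j \<in> J \<Longrightarrow> l \<in> J \<Longrightarrow>
      (\<Sum>v\<in>V. \<Sum>w\<in>V. conjugate (u j v) * a v w * u l w) = (if j = l then of_dual_number (\<kappa> j) else 0)"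
    and r: "\<And>j c. conjugate (b j) * of_dual_number c * b j = of_dual_number (c * r j)"
    and x: "\<And>v. x v = (\<Sum>j\<in>J. u j v * b j)"
  shows "(\<Sum>v\<in>V. \<Sum>w\<in>V. conjugate (x v) * a v w * x w) = of_dual_number (\<Sum>j\<in>J. \<kappa> j * r j)"
proof -
  have "(\<Sum>v\<in>V. \<Sum>w\<in>V. conjugate (x v) * a v w * x w)
    = (\<Sum>v\<in>V. \<Sum>w\<in>V. \<Sum>j\<in>J. \<Sum>l\<in>J. conjugate (b j) * (conjugate (u j v) * a v w * u l w) * b l)"
    by (simp add: x dual_conjugate_sum dual_conjugate_mult sum_distrib_left sum_distrib_right mult.assoc
        cong: sum.cong) (subst sum.swap [of _ J J], simp)
  also have "\<dots> = (\<Sum>j\<in>J. \<Sum>l\<in>J. \<Sum>v\<in>V. \<Sum>w\<in>V. conjugate (b j) * (conjugate (u j v) * a v w * u l w) * b l)"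
    by (simp add: sum.swap [of _ J V])
  also have "\<dots> = (\<Sum>j\<in>J. \<Sum>l\<in>J. conjugate (b j) * (\<Sum>v\<in>V. \<Sum>w\<in>V. conjugate (u j v) * a v w * u l w) * b l)"
    by (simp add: sum_distrib_left sum_distrib_right)
  also have "\<dots> = (\<Sum>j\<in>J. \<Sum>l\<in>J. if j = l then of_dual_number (\<kappa> j * r j) else 0)"
    by (intro sum.cong refl) (use diag r in auto)
  also have "\<dots> = of_dual_number (\<Sum>j\<in>J. \<kappa> j * r j)"
    using assms(1) by (simp add: of_dual_number_sum)
  finally show ?thesis .
qed

definition diagonal_frame ::
  "'v set \<Rightarrow> ('v \<Rightarrow> 'v \<Rightarrow> 'a :: gain_scalar dual_elem) \<Rightarrow> 'j set \<Rightarrow>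
    ('j \<Rightarrow> 'v \<Rightarrow> 'a dual_elem) \<Rightarrow> ('j \<Rightarrow> real dual_elem) \<Rightarrow> bool"
where
  "diagonal_frame V a J u \<kappa> \<longleftrightarrow> (\<forall>j\<in>J. \<forall>l\<in>J.
    (\<Sum>v\<in>V. conjugate (u j v) * u l v) = (if j = l then 1 else 0) \<and>
    (\<Sum>v\<in>V. \<Sum>w\<in>V. conjugate (u j v) * a v w * u l w) = (if j = l then of_dual_number (\<kappa> j) else 0))"

lemma diagonal_frame_subset:
  "diagonal_frame V a J u \<kappa> \<Longrightarrow> J' \<subseteq> J \<Longrightarrow> diagonal_frame V a J' u \<kappa>"
  unfolding diagonal_frame_def by blast

lemma diagonal_frame_quadratic_forms:
  fixes u :: "'j \<Rightarrow> 'v \<Rightarrow> 'a :: gain_scalar dual_elem"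
  assumes "finite V" "finite J" "diagonal_frame V a J u \<kappa>"
    and r: "\<And>j c. conjugate (b j) * of_dual_number c * b j = of_dual_number (c * r j)"
    and x: "\<And>v. x v = (\<Sum>j\<in>J. u j v * b j)"
  shows "(\<Sum>v\<in>V. conjugate (x v) * x v) = of_dual_number (\<Sum>j\<in>J. r j)"
    and "(\<Sum>v\<in>V. \<Sum>w\<in>V. conjugate (x v) * a v w * x w) = of_dual_number (\<Sum>j\<in>J. \<kappa> j * r j)"
proof -
  let ?id = "\<lambda>v w. if v = w then 1 else (0 :: 'a dual_elem)"
  have id: "(\<Sum>v\<in>V. \<Sum>w\<in>V. conjugate (y v) * ?id v w * z w) = (\<Sum>v\<in>V. conjugate (y v) * z v)"
    for y z :: "'v \<Rightarrow> 'a dual_elem"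
    using assms(1) by (simp add: if_distrib [of "\<lambda>t. conjugate _ * t * _"] cong: if_cong)
  have "(\<Sum>v\<in>V. \<Sum>w\<in>V. conjugate (x v) * ?id v w * x w) = of_dual_number (\<Sum>j\<in>J. 1 * r j)"
    by (rule quadratic_form_diagonal [OF assms(2) _ r x])
      (use assms(3) in \<open>simp add: id diagonal_frame_def\<close>)
  then show "(\<Sum>v\<in>V. conjugate (x v) * x v) = of_dual_number (\<Sum>j\<in>J. r j)"
    by (simp add: id)
  show "(\<Sum>v\<in>V. \<Sum>w\<in>V. conjugate (x v) * a v w * x w) = of_dual_number (\<Sum>j\<in>J. \<kappa> j * r j)"
    by (rule quadratic_form_diagonal [OF assms(2) _ r x])
      (use assms(3) in \<open>simp add: diagonal_frame_def\<close>)
qed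

lemma diagonal_frames_compare:
  fixes u :: "'j \<Rightarrow> 'v \<Rightarrow> 'a :: gain_scalar dual_elem" and w :: "'l \<Rightarrow> 'v \<Rightarrow> 'a dual_elem"
  assumes fin: "finite V" "finite J" "finite L"
    and card: "card V < card J + card L"
    and u: "diagonal_frame V a J u \<kappa>" and w: "diagonal_frame V a L w \<mu>"
    and upper: "\<And>j. j \<in> J \<Longrightarrow> \<kappa> j \<le> \<alpha>" and lower: "\<And>l. l \<in> L \<Longrightarrow> \<beta> \<le> \<mu> l"
  shows "\<beta> \<le> \<alpha>"
proof -
  obtain z where z: "\<And>v. v \<in> V \<Longrightarrow> (\<Sum>k\<in>J <+> L. case_sum (\<lambda>j. u j v) (\<lambda>l. w l v) k * z k) = 0"
    and nz: "\<exists>k\<in>J <+> L. std_part (z k) \<noteq> 0"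
    using underdetermined_system_solution [of V "J <+> L" "\<lambda>v. case_sum (\<lambda>j. u j v) (\<lambda>l. w l v)"] fin card
    by (auto simp: card_Plus)
  define b where "b j = z (Inl j)" for j
  define c where "c l = - z (Inr l)" for l
  define x where "x v = (\<Sum>j\<in>J. u j v * b j)" for v
  define y where "y v = (\<Sum>l\<in>L. w l v * c l)" for v
  have xy: "x v = y v" if "v \<in> V" for v
  proof -
    have "x v + - y v = 0"
      using z [OF that] fin by (simp add: sum.Plus x_def y_def b_def c_def sum_negf)
    then show ?thesis by simp
  qed
  obtain N :: "'a dual_elem \<Rightarrow> real dual_elem" where N_nonneg: "\<And>p. 0 \<le> N p"
    and N_std: "\<And>p. std_part (N p) = (norm (std_part p))\<^sup>2"
    and N: "\<And>p c. conjugate p * of_dual_number c * p = of_dual_number (c * N p)"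
    using conjugate_mult_self_dual_number by metis
  note X = diagonal_frame_quadratic_forms [OF fin(1,2) u N x_def]
  note Y = diagonal_frame_quadratic_forms [OF fin(1,3) w N y_def]
  have "(\<Sum>v\<in>V. conjugate (x v) * x v) = (\<Sum>v\<in>V. conjugate (y v) * y v)"
    by (simp add: xy)
  then have norm: "(\<Sum>j\<in>J. N (b j)) = (\<Sum>l\<in>L. N (c l))"
    by (simp add: X(1) Y(1))
  have "(\<Sum>v\<in>V. \<Sum>w\<in>V. conjugate (x v) * a v w * x w) = (\<Sum>v\<in>V. \<Sum>w\<in>V. conjugate (y v) * a v w * y w)"
    by (simp add: xy)
  then have form: "(\<Sum>j\<in>J. \<kappa> j * N (b j)) = (\<Sum>l\<in>L. \<mu> l * N (c l))"
    by (simp add: X(2) Y(2))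
  have pos: "0 < std_part (\<Sum>i\<in>A. N (f i))" if "finite A" "i \<in> A" "std_part (f i) \<noteq> 0"
    for A :: "'k set" and f i
    using that by (simp add: std_part_sum N_std) (intro sum_pos2 [of _ i], auto)
  have "0 < std_part (\<Sum>j\<in>J. N (b j))"
  proof -
    from nz consider j where "j \<in> J" "std_part (b j) \<noteq> 0" | l where "l \<in> L" "std_part (c l) \<noteq> 0"
      by (auto simp: b_def c_def uminus_dual_elem_def)
    then show ?thesis
    proof cases
      case 1
      with fin(2) show ?thesis by (rule pos)
    next
      case 2
      with fin(3) show ?thesis unfolding norm by (rule pos)
    qed
  qed
  moreover have "\<beta> * (\<Sum>j\<in>J. N (b j)) \<le> \<alpha> * (\<Sum>j\<in>J. N (b j))"
  proof -
    have "\<beta> * (\<Sum>j\<in>J. N (b j)) = (\<Sum>l\<in>L. \<beta> * N (c l))"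
      by (simp add: norm sum_distrib_left)
    also have "\<dots> \<le> (\<Sum>l\<in>L. \<mu> l * N (c l))"
      by (intro sum_mono mult_right_mono lower N_nonneg)
    also have "\<dots> \<le> (\<Sum>j\<in>J. \<alpha> * N (b j))"
      unfolding form [symmetric] by (intro sum_mono mult_right_mono upper N_nonneg)
    finally show ?thesis by (simp add: sum_distrib_left)
  qed
  ultimately show ?thesis by (rule dual_mult_right_le_imp_le [rotated])
qed

section \<open>Eigenvectors as functions on the vertices\<close>

lemma eigenvalue_list_diagonal_frame:
  fixes a :: "'v \<Rightarrow> 'v \<Rightarrow> 'a :: gain_scalar dual_elem"
  assumes "distinct vs"
    and "eigenvalue_list (mat (length vs) (length vs) (\<lambda>(i, j). a (vs ! i) (vs ! j))) ls"
  obtains u where "diagonal_frame (set vs) a {..<length vs} u ((!) ls)"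
proof -
  let ?n = "length vs"
  let ?A = "mat ?n ?n (\<lambda>(i, j). a (vs ! i) (vs ! j))"
  obtain U where U: "U \<in> carrier_mat ?n ?n" and gram: "dual_adjoint U * U = 1\<^sub>m ?n"
    and diag: "dual_adjoint U * ?A * U = mat_diag ?n (\<lambda>i. of_dual_number (ls ! i))"
    using assms(2) by (auto simp: eigenvalue_list_def Let_def)
  have bij: "bij_betw ((!) vs) {..<?n} (set vs)"
    using assms(1) by (rule bij_betw_nth) auto
  define idx where "idx = inv_into {..<?n} ((!) vs)"
  have idx: "idx (vs ! i) = i" if "i < ?n" for i
    using that bij by (simp add: idx_def bij_betw_inv_into_left)
  define u where "u j v = U $$ (idx v, j)" for j v
  have reindex: "(\<Sum>v\<in>set vs. g v) = (\<Sum>i<?n. g (vs ! i))" for g :: "'v \<Rightarrow> 'a dual_elem"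
    by (rule sum.reindex_bij_betw [OF bij, symmetric])
  have "diagonal_frame (set vs) a {..<?n} u ((!) ls)"
    unfolding diagonal_frame_def
  proof (intro ballI conjI)
    fix j l assume jl: "j \<in> {..<?n}" "l \<in> {..<?n}"
    have "(dual_adjoint U * U) $$ (j, l) = (\<Sum>i<?n. conjugate (U $$ (i, j)) * U $$ (i, l))"
      using U jl by (simp add: dual_adjoint_def scalar_prod_def atLeast0LessThan)
    then show "(\<Sum>v\<in>set vs. conjugate (u j v) * u l v) = (if j = l then 1 else 0)"
      using jl by (simp add: reindex gram u_def idx)
    have "(dual_adjoint U * ?A * U) $$ (j, l)
      = (\<Sum>i'<?n. (\<Sum>i<?n. conjugate (U $$ (i, j)) * a (vs ! i) (vs ! i')) * U $$ (i', l))"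
      using U jl by (simp add: dual_adjoint_def scalar_prod_def atLeast0LessThan)
    also have "\<dots> = (\<Sum>i<?n. \<Sum>i'<?n. conjugate (U $$ (i, j)) * a (vs ! i) (vs ! i') * U $$ (i', l))"
      by (simp add: sum_distrib_right) (rule sum.swap)
    also have "\<dots> = (\<Sum>v\<in>set vs. \<Sum>w\<in>set vs. conjugate (u j v) * a v w * u l w)"
      by (simp add: reindex u_def idx)
    finally show "(\<Sum>v\<in>set vs. \<Sum>w\<in>set vs. conjugate (u j v) * a v w * u l w)
      = (if j = l then of_dual_number (ls ! j) else 0)"
      unfolding diag using jl by (subst (asm) eq_commute) (simp add: mat_diag_def)
  qed
  then show thesis by (rule that)
qed

lemma diagonal_frame_extend_by_zero:
  fixes u :: "'j \<Rightarrow> 'v \<Rightarrow> 'a :: gain_scalar dual_elem"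
  assumes "finite V" "S \<subseteq> V" and frame: "diagonal_frame S a' J u \<kappa>"
    and a: "\<And>v w. v \<in> S \<Longrightarrow> w \<in> S \<Longrightarrow> a' v w = a v w"
  shows "diagonal_frame V a J (\<lambda>j v. if v \<in> S then u j v else 0) \<kappa>"
proof -
  let ?u = "\<lambda>j v. if v \<in> S then u j v else 0"
  have "(\<Sum>v\<in>V. conjugate (?u j v) * ?u l v) = (\<Sum>v\<in>S. conjugate (u j v) * u l v)" for j l
    using assms(1,2) by (intro sum.mono_neutral_cong_right) auto
  moreover have "(\<Sum>v\<in>V. \<Sum>w\<in>V. conjugate (?u j v) * a v w * ?u l w)
      = (\<Sum>v\<in>S. \<Sum>w\<in>S. conjugate (u j v) * a' v w * u l w)" for j l
    using assms(1,2) by (intro sum.mono_neutral_cong_right) (auto simp: a)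
  ultimately show ?thesis
    using frame by (simp add: diagonal_frame_def)
qed

theorem theorem4p2:
  fixes G :: "'v pair_pre_digraph"
    and \<phi> :: "'v \<times> 'v \<Rightarrow> 'a :: gain_scalar dual_elem"
    and S :: "'v set"
    and vs ws :: "'v list"
    and ls ms :: "real dual_elem list"
    and n k :: nat
  assumes "dual_unit_gain_graph G \<phi>"
    and "n = card (pverts G)"
    and "S \<subseteq> pverts G" and "card S = k" and "1 \<le> k" and "k \<le> n"
    and "distinct vs" and "set vs = pverts G"
    and "distinct ws" and "set ws = S"
    and "eigenvalue_list (adjacency_matrix (with_proj G) \<phi> vs) ls"
    and "sorted_wrt (\<ge>) ls"
    and "eigenvalue_list (adjacency_matrix (with_proj G \<restriction> S) \<phi> ws) ms"
    and "sorted_wrt (\<ge>) ms"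
  shows "\<forall>i\<in>{1..k}. ls ! (i - 1) \<ge> ms ! (i - 1) \<and> ms ! (i - 1) \<ge> ls ! (n + i - k - 1)"
proof
  fix i assume i: "i \<in> {1..k}"
  let ?V = "pverts G"
  define a where "a v w = (if (v, w) \<in> parcs G then \<phi> (v, w) else 0)" for v w
  define a' where "a' v w = (if (v, w) \<in> arcs (with_proj G \<restriction> S) then \<phi> (v, w) else 0)" for v w
  have len: "length vs = n" "length ws = k"
    using assms distinct_card by metis+
  have len_ev: "length ls = n" "length ms = k"
    using assms(11,13) len by (auto simp: eigenvalue_list_def adjacency_matrix_def Let_def)
  have fin: "finite ?V" using assms(8) by (metis List.finite_set)
  have "adjacency_matrix (with_proj G) \<phi> vs = mat (length vs) (length vs) (\<lambda>(i, j). a (vs ! i) (vs ! j))"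
    by (simp add: adjacency_matrix_def a_def)
  then obtain u where u: "diagonal_frame ?V a {..<n} u ((!) ls)"
    using eigenvalue_list_diagonal_frame [of vs a ls] assms(7,8,11) len by metis
  have "adjacency_matrix (with_proj G \<restriction> S) \<phi> ws = mat (length ws) (length ws) (\<lambda>(i, j). a' (ws ! i) (ws ! j))"
    by (simp add: adjacency_matrix_def a'_def)
  then obtain w' where w': "diagonal_frame S a' {..<k} w' ((!) ms)"
    using eigenvalue_list_diagonal_frame [of ws a' ms] assms(9,10,13) len by metis
  have "a' v w = a v w" if "v \<in> S" "w \<in> S" for v w
    using that by (simp add: a_def a'_def induce_subgraph_def)
  then obtain w where w: "diagonal_frame ?V a {..<k} w ((!) ms)"
    using diagonal_frame_extend_by_zero [OF fin assms(3) w', of a] by blast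
  have ls_mono: "ls ! q \<le> ls ! p" if "p \<le> q" "q < n" for p q
    using sorted_wrt_nth_less [OF assms(12), of p q] that len_ev by (cases "p = q") auto
  have ms_mono: "ms ! q \<le> ms ! p" if "p \<le> q" "q < k" for p q
    using sorted_wrt_nth_less [OF assms(14), of p q] that len_ev by (cases "p = q") auto
  show "ls ! (i - 1) \<ge> ms ! (i - 1) \<and> ms ! (i - 1) \<ge> ls ! (n + i - k - 1)"
  proof
    show "ms ! (i - 1) \<le> ls ! (i - 1)"
    proof (rule diagonal_frames_compare [of ?V "{i - 1..<n}" "{..<i}"])
      show "diagonal_frame ?V a {i - 1..<n} u ((!) ls)" "diagonal_frame ?V a {..<i} w ((!) ms)"
        using i assms(6) by (auto intro: diagonal_frame_subset [OF u] diagonal_frame_subset [OF w])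
    qed (use fin i assms(2,6) in \<open>auto intro!: ls_mono ms_mono\<close>)
    show "ls ! (n + i - k - 1) \<le> ms ! (i - 1)"
    proof (rule diagonal_frames_compare [of ?V "{i - 1..<k}" "{..<n + i - k}"])
      show "diagonal_frame ?V a {i - 1..<k} w ((!) ms)" "diagonal_frame ?V a {..<n + i - k} u ((!) ls)"
        using i assms(6) by (auto intro: diagonal_frame_subset [OF u] diagonal_frame_subset [OF w])
    qed (use fin i assms(2,6) in \<open>auto intro!: ls_mono ms_mono\<close>)
  qed
qed

end
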